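(* Let $p\in\mathbb N$ with $(p+1)\alpha>1$ and let $F_a\in C_b^{p+1}(\mathbb R^e;\mathbb R^e)$ for $a\in\mathcal A=\{1,\dots,m\}$. Suppose that there is a constant $C_{\mathrm{CRK}}>0$ such that $\|\mathcal Z^{(a)}_{u,v}\|_\infty+|\zeta^{(a)}_{u,v}|_\infty\le C_{\mathrm{CRK}}|v-u|^\alpha$ for every $[u,v]\subset[0,T]$ and $a\in\mathcal A$, and that the stage system $$Y_i^{u,v}(y)=y+\sum_{a=1}^m\sum_{j=1}^q(\mathcal Z^{(a)}_{u,v})_{i,j}F_a(Y_j^{u,v}(y)),\qquad i=1,\dots,q,$$ admits a solution on each one-step interval $[u,v]\subset[0,T]$ for every $y\in\mathbb R^e$. Let $$\Psi^{\mathrm{CRK}}_{u,v}(y):=y+\sum_{a=1}^m\sum_{i=1}^q(\zeta^{(a)}_{u,v})_iF_a(Y_i^{u,v}(y)).$$ Then for any $R>0$ there exists a constant $C_{p,R,T}>0$ such that, for any $0\le u\le v\le T$ and any $y\in\mathbb R^e$ with $|y|\le R$, the stage values satisfy $$Y_i^{u,v}(y)=y+\sum_{\tau\in\mathcal T_{\le p}}\frac{(\Phi_{u,v}(\tau))_i}{\sigma(\tau)}F(\tau)(y)+\mathcal R^{(p+1)}_{i,u,v}(y),\qquad i=1,\dots,q,$$ and the controlled Runge-Kutta map satisfies $$\Psi^{\mathrm{CRK}}_{u,v}(y)=y+\sum_{\tau\in\mathcal T_{\le p}}\frac{a_{u,v}(\tau)}{\sigma(\tau)}F(\tau)(y)+\mathcal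 R^{(p+1)}_{u,v}(y),$$ with $$\max_{1\le i\le q}|\mathcal R^{(p+1)}_{i,u,v}(y)|+|\mathcal R^{(p+1)}_{u,v}(y)|\le C_{p,R,T}|v-u|^{(p+1)\alpha}.$$
   Context: Fix $\alpha\in(1/3,1/2]$, $T>0$ and $m,e,q\in\mathbb N=\{1,2,\dots\}$. For each $[u,v]\subset[0,T]$ and $a\in\mathcal A=\{1,\dots,m\}$, a matrix $\mathcal Z^{(a)}_{u,v}\in\mathbb R^{q\times q}$ and a vector $\zeta^{(a)}_{u,v}\in\mathbb R^q$ are prescribed (their entries may depend on stepwise coefficients of the driving path over $[u,v]$). $|\cdot|_\infty$ is the max norm on $\mathbb R^q$ and $\|\cdot\|_\infty$ the matrix norm on $\mathbb R^{q\times q}$ induced by it. $C_b^k$ denotes $k$ times continuously differentiable maps with all derivatives of orders $0,\dots,k$ bounded. $Y_i^{u,v}(y)$ denotes the components of a solution of the stage system, used also in $\Psi^{\mathrm{CRK}}_{u,v}(y)$. Trees. $\mathcal T$ is the set of (nonplanar) rooted trees with vertices decorated by $\mathcal A$, $\mathbf 1$ is the empty tree, $\mathcal T^0=\mathcal T\sqcup\{\mathbf 1\}$. $[\tau_1\cdots\tau_n]_a$ is the tree obtained by joining the roots of $\tau_1,\dots,\tau_n$ to a new root decorated by $a$; $\bullet_a=[\mathbf 1]_a$. $|\tau|$ is the number of vertices; $\mathcal T_{\le p}=\{\tau\in\mathcal T:|\tau|\le p\}$. Symmetry factor: $\sigma(\mathbf 1)=\sigma(\bullet_a)=1$, $\sigma([\rho_1^{m_1}\cdots\rho_\ell^{m_\ell}]_a)=\prod_jm_j!\,\sigma(\rho_j)^{m_j}$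 for distinct $\rho_j$ with multiplicities $m_j$. Elementary differentials: $F(\bullet_a)(y)=F_a(y)$, $F([\tau_1\cdots\tau_n]_a)(y)=D^nF_a(y)[F(\tau_1)(y),\dots,F(\tau_n)(y)]$. Numerical tree coefficients. With $\odot$ the componentwise product on $\mathbb R^q$ and $\mathbf 1_q=(1,\dots,1)^\top$ (the empty product): $\Phi_{u,v}(\mathbf 1)=\mathbf 1_q$, $a_{u,v}(\mathbf 1)=1$, and for $\tau=[\tau_1\cdots\tau_n]_a$, $$\Phi_{u,v}(\tau)=\mathcal Z^{(a)}_{u,v}\bigl(\Phi_{u,v}(\tau_1)\odot\cdots\odot\Phi_{u,v}(\tau_n)\bigr),\qquad a_{u,v}(\tau)=\bigl\langle\zeta^{(a)}_{u,v},\Phi_{u,v}(\tau_1)\odot\cdots\odot\Phi_{u,v}(\tau_n)\bigr\rangle_{\mathbb R^q};$$ in particular $\Phi_{u,v}(\bullet_a)=\mathcal Z^{(a)}_{u,v}\mathbf 1_q$ and $a_{u,v}(\bullet_a)=\langle\zeta^{(a)}_{u,v},\mathbf 1_q\rangle$. *)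

theory Defs
  imports "HOL-Analysis.Analysis" "HOL-Library.Multiset"
begin

text \<open>
  Nonplanar rooted trees with decorated vertices: the subtrees joined to the root form a multiset,
  so \<open>Node a {#\<tau>\<^sub>1, \<dots>, \<tau>\<^sub>n#}\<close> is \<open>[\<tau>\<^sub>1\<cdots>\<tau>\<^sub>n]\<^sub>a\<close> and \<open>Node a {#}\<close> is the one-vertex tree.
  The empty tree is not an element of this type.
\<close>

datatype 'a tree = Node 'a "'a tree multiset"

primrec vertices :: "'a tree \<Rightarrow> nat" where
  "vertices (Node a M) = Suc (\<Sum>n \<in># image_mset vertices M. n)"

definition trees_upto :: "nat \<Rightarrow> 'a tree set" where
  "trees_upto p = {\<tau>. vertices \<tau> \<le> p}"

lemma vertices_child_less:
  assumes "\<rho> \<in># M"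
  shows "vertices \<rho> < vertices (Node a M)"
  using assms by (auto dest!: multi_member_split)

text \<open>
  The product runs over the distinct subtrees of the root, \<open>count M \<rho>\<close> being the multiplicity.
\<close>

function symmetry :: "'a tree \<Rightarrow> nat" where
  "symmetry (Node a M) = (\<Prod>\<rho> \<in> set_mset M. fact (count M \<rho>) * symmetry \<rho> ^ count M \<rho>)"
  by pat_completeness auto
termination
  by (relation "Wellfounded.measure vertices") (auto dest: vertices_child_less simp del: vertices.simps)

text \<open>
  \<open>nderiv f [v\<^sub>1, \<dots>, v\<^sub>n] x\<close> is \<open>D\<^sup>nf(x)[v\<^sub>1, \<dots>, v\<^sub>n]\<close>, where \<open>D\<^sup>nf(\<cdot>)[v\<^sub>1, \<dots>, v\<^sub>n]\<close> is
  the derivative of \<open>D\<^sup>n\<^sup>-\<^sup>1f(\<cdot>)[v\<^sub>2, \<dots>, v\<^sub>n]\<close> in direction \<open>v\<^sub>1\<close>.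
\<close>

primrec nderiv ::
  "('a::euclidean_space \<Rightarrow> 'b::real_normed_vector) \<Rightarrow> 'a list \<Rightarrow> 'a \<Rightarrow> 'b" where
  "nderiv f [] = f"
| "nderiv f (v # vs) = (\<lambda>x. frechet_derivative (nderiv f vs) (at x) v)"

text \<open>
  The class \<open>C\<^sub>b\<^sup>k\<close>. As the domain is finite-dimensional, differentiability and continuity of
  \<open>D\<^sup>jf(\<cdot>)\<close> as a map into the multilinear forms amount to the same for each fixed list of
  directions. The last condition bounds the multilinear operator norm of \<open>D\<^sup>jf(x)\<close>
  uniformly in \<open>x\<close>, for every order from \<open>0\<close> to \<open>k\<close>.
\<close>

definition Cb :: "nat \<Rightarrow> ('a::euclidean_space \<Rightarrow> 'b::real_normed_vector) \<Rightarrow> bool" where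
  "Cb k f \<longleftrightarrow>
    (\<forall>vs x. length vs < k \<longrightarrow> nderiv f vs differentiable (at x)) \<and>
    (\<forall>vs. length vs \<le> k \<longrightarrow> continuous_on UNIV (nderiv f vs)) \<and>
    (\<forall>j\<le>k. \<exists>B. \<forall>vs x. length vs = j \<longrightarrow> norm (nderiv f vs x) \<le> B * (\<Prod>v\<leftarrow>vs. norm v))"

text \<open>
  Elementary differentials. The children of a node carry no order, so their values are listed in
  an arbitrary order; by the symmetry of \<open>D\<^sup>nF\<^sub>a(y)\<close> the choice is immaterial whenever \<open>F\<^sub>a\<close> is
  of class \<open>C\<^sup>n\<close>.
\<close>

primrec elem_diff ::
  "('a \<Rightarrow> 'b \<Rightarrow> 'b) \<Rightarrow> 'a tree \<Rightarrow> 'b \<Rightarrow> 'b::euclidean_space" where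
  "elem_diff F (Node a M) =
    (\<lambda>y. nderiv (F a) (SOME vs. mset vs = image_mset (\<lambda>d. d y) (image_mset (elem_diff F) M)) y)"

text \<open>
  On \<open>real ^ 'q\<close> the library's \<open>*\<close> and \<open>1\<close> are the componentwise product and the vector
  \<open>(1, \<dots>, 1)\<close>; the arguments \<open>Z\<close> and \<open>\<zeta>\<close> are the coefficients of one interval \<open>[u, v]\<close>.
\<close>

primrec stage_coeff :: "('a \<Rightarrow> real ^ 'q ^ 'q) \<Rightarrow> 'a tree \<Rightarrow> real ^ 'q" where
  "stage_coeff Z (Node a M) = Z a *v (\<Prod>\<phi> \<in># image_mset (stage_coeff Z) M. \<phi>)"

primrec step_coeff ::
  "('a \<Rightarrow> real ^ 'q ^ 'q) \<Rightarrow> ('a \<Rightarrow> real ^ 'q) \<Rightarrow> 'a tree \<Rightarrow> real" where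
  "step_coeff Z \<zeta> (Node a M) = \<zeta> a \<bullet> (\<Prod>\<tau> \<in># M. stage_coeff Z \<tau>)"

text \<open>
  The matrix norm induced by the max norm, which is \<open>infnorm\<close> in the library; the value at
  \<open>x = 0\<close> is \<open>0 / 0 = 0\<close> and does not affect the supremum.
\<close>

definition mat_infnorm :: "real ^ 'q ^ 'q \<Rightarrow> real" where
  "mat_infnorm A = (SUP x. infnorm (A *v x) / infnorm x)"

definition stage_solution ::
  "('a::finite \<Rightarrow> 'b \<Rightarrow> 'b::real_vector) \<Rightarrow> ('a \<Rightarrow> real ^ 'q ^ 'q) \<Rightarrow> 'b \<Rightarrow> ('q \<Rightarrow> 'b) \<Rightarrow> bool" where
  "stage_solution F Z y Y \<longleftrightarrow>
    (\<forall>i. Y i = y + (\<Sum>a\<in>UNIV. \<Sum>j\<in>UNIV. (Z a $ i $ j) *\<^sub>R F a (Y j)))"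

definition crk_map ::
  "('a::finite \<Rightarrow> 'b \<Rightarrow> 'b::real_vector) \<Rightarrow> ('a \<Rightarrow> real ^ 'q) \<Rightarrow> ('q \<Rightarrow> 'b) \<Rightarrow> 'b \<Rightarrow> 'b" where
  "crk_map F \<zeta> Y y = y + (\<Sum>a\<in>UNIV. \<Sum>i\<in>UNIV. (\<zeta> a $ i) *\<^sub>R F a (Y i))"

lemma finite_trees_upto: "finite (trees_upto p :: 'a::finite tree set)"
proof (induction p)
  case 0
  have "vertices \<tau> > 0" for \<tau> :: "'a tree"
    by (cases \<tau>) simp
  then have "trees_upto 0 = ({} :: 'a tree set)"
    by (auto simp: trees_upto_def)
  then show ?case by simp
next
  case (Suc p)
  have pos: "vertices \<tau> \<ge> 1" for \<tau> :: "'a tree"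
    by (cases \<tau>) simp
  have size_le: "size M \<le> (\<Sum>n \<in># image_mset vertices M. n)" for M :: "'a tree multiset"
  proof (induction M)
    case (add x M)
    then show ?case using pos[of x] by simp
  qed simp
  let ?L = "{xs :: 'a tree list. set xs \<subseteq> trees_upto p \<and> length xs \<le> p}"
  have fin: "finite ?L"
    using Suc.IH by (rule finite_lists_length_le)
  have "trees_upto (Suc p) \<subseteq> (\<lambda>(a, xs). Node a (mset xs)) ` (UNIV \<times> ?L)"
  proof
    fix \<tau> :: "'a tree"
    assume \<tau>: "\<tau> \<in> trees_upto (Suc p)"
    obtain a M where [simp]: "\<tau> = Node a M" by (cases \<tau>)
    obtain xs where [simp]: "M = mset xs" by (metis ex_mset)
    have "length xs \<le> p"
      using size_le[of M] \<tau> by (simp add: trees_upto_def)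
    moreover have "set xs \<subseteq> trees_upto p"
    proof
      fix \<rho> assume "\<rho> \<in> set xs"
      then have "vertices \<rho> < vertices (Node a M)"
        by (intro vertices_child_less) simp
      then show "\<rho> \<in> trees_upto p"
        using \<tau> by (simp add: trees_upto_def)
    qed
    ultimately show "\<tau> \<in> (\<lambda>(a, xs). Node a (mset xs)) ` (UNIV \<times> ?L)"
      by (auto intro!: image_eqI[where x = "(a, xs)"])
  qed
  then show ?case
    by (rule finite_subset) (simp add: fin)
qed

lemma bdd_above_mat_infnorm: "bdd_above (range (\<lambda>x. infnorm (A *v x) / infnorm (x :: real ^ 'q)))"
proof -
  have "infnorm (A *v x) / infnorm x \<le> onorm ((*v) A) * sqrt (DIM(real ^ 'q))" for x
  proof (cases "x = 0")
    case True
    then show ?thesis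
      by (simp add: infnorm_0 onorm_pos_le)
  next
    case False
    have "infnorm (A *v x) \<le> norm (A *v x)"
      by (rule infnorm_le_norm)
    also have "\<dots> \<le> onorm ((*v) A) * norm x"
      by (intro onorm) simp
    also have "\<dots> \<le> onorm ((*v) A) * (sqrt (DIM(real ^ 'q)) * infnorm x)"
      by (intro mult_left_mono norm_le_infnorm onorm_pos_le) simp
    finally show ?thesis
      using False by (simp add: pos_divide_le_eq infnorm_pos_lt mult.assoc)
  qed
  then show ?thesis by (intro bdd_aboveI) auto
qed

end

theory Submission
  imports Defs "HOL-Combinatorics.Multiset_Permutations"
begin

text \<open>
  Write \<open>c = C\<^sub>C\<^sub>R\<^sub>K \<bar>v - u\<bar> powr \<alpha>\<close>; every entry of \<open>Z\<close> and of \<open>\<zeta>\<close> is bounded by \<open>c\<close>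
  (\<open>abs_entry_le_mat_infnorm\<close>). The proof raises the order of the stage expansion one at a time. Since
  the fields are bounded, the stage equation gives \<open>Y i = y + O(c)\<close>. Suppose that the stages agree with
  their tree expansion over the trees with at most \<open>k\<close> vertices up to \<open>O(c ^ (k + 1))\<close>. Inserting this
  into \<open>F a (Y j)\<close> and Taylor expanding around \<open>y\<close> gives \<open>F a (Y j)\<close> up to the same error, and the
  further factor \<open>Z a $ i $ j = O(c)\<close> in the stage equation gives the stages up to \<open>O(c ^ (k + 2))\<close>. The
  step has the same form as a stage, with \<open>\<zeta> a\<close> in place of a row of \<open>Z a\<close>, so it is covered by the same
  estimate (\<open>crk_map_expansion\<close>).

  The expansion of \<open>F a (Y j)\<close> is where trees arise. The coefficient of a tree \<open>\<tau>\<close> has size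
  \<open>O(c ^ vertices \<tau>)\<close>, so the increment is a sum of terms of different orders. By multilinearity the
  Taylor polynomial becomes a sum over lists of trees. Lists of total weight above \<open>k\<close> go into the
  remainder; the others are grouped by their multiset of entries, which is possible since higher
  derivatives are symmetric (\<open>nderiv_mset_cong\<close>). Counting the lists with a given content turns the
  Taylor factor \<open>1 / n!\<close> into the reciprocal of the multiplicity factorials (\<open>Taylor_multi_index\<close>).
  Together with the symmetry factors of the subtrees this is the symmetry factor of the tree obtained
  by adding a root decorated by \<open>a\<close>, and its elementary differential is the derivative of \<open>F a\<close> in
  the directions given by the subtrees.

  The derivatives of the fields up to order \<open>p + 1\<close> are bounded on the whole space, so the constants are uniform in the initial value
  \<open>y\<close>.
\<close>

section \<open>Symmetry of iterated directional derivatives\<close>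

lemma has_real_derivative_along_line:
  fixes g :: "'a::euclidean_space \<Rightarrow> 'b::real_inner"
  assumes "g differentiable (at (x + t *\<^sub>R v))"
  shows "((\<lambda>t. e \<bullet> g (x + t *\<^sub>R v)) has_real_derivative
           e \<bullet> frechet_derivative g (at (x + t *\<^sub>R v)) v) (at t)"
proof -
  have D: "(g has_derivative frechet_derivative g (at (x + t *\<^sub>R v))) (at (x + t *\<^sub>R v))"
    using assms frechet_derivative_works by blast
  have lin: "linear (frechet_derivative g (at (x + t *\<^sub>R v)))"
    using assms by (rule linear_frechet_derivative)
  have "((\<lambda>t. g (x + t *\<^sub>R v)) has_derivative
          (\<lambda>s. frechet_derivative g (at (x + t *\<^sub>R v)) (s *\<^sub>R v))) (at t)"
    by (rule has_derivative_compose[where f = "\<lambda>t. x + t *\<^sub>R v", OF _ D])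
       (auto intro!: derivative_eq_intros)
  then have "((\<lambda>t. e \<bullet> g (x + t *\<^sub>R v)) has_derivative
          (\<lambda>s. e \<bullet> frechet_derivative g (at (x + t *\<^sub>R v)) (s *\<^sub>R v))) (at t)"
    by (intro derivative_intros)
  then show ?thesis
    by (simp add: has_field_derivative_def linear_cmul[OF lin] mult.commute[of _ "_ \<bullet> _"])
qed

text \<open>
  Two applications of the mean value theorem, first in direction \<open>v\<close> and then in direction \<open>w\<close>,
  turn the second difference over a small parallelogram into one value of a mixed derivative. The
  second difference is symmetric in \<open>v\<close> and \<open>w\<close>; that is what makes the mixed derivatives agree in
  the limit. Pairing with a fixed vector \<open>e\<close> makes everything real valued, where the mean value
  theorem holds as an equality.
\<close>

lemma second_difference_mean_value:
  fixes g :: "'a::euclidean_space \<Rightarrow> 'b::real_inner"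
  assumes g: "\<And>x. g differentiable (at x)"
    and gv: "\<And>x. nderiv g [v] differentiable (at x)"
    and h: "h > 0"
  shows "\<exists>s t. 0 < s \<and> s < h \<and> 0 < t \<and> t < h \<and>
    e \<bullet> (g (x + h *\<^sub>R v + h *\<^sub>R w) - g (x + h *\<^sub>R v) - g (x + h *\<^sub>R w) + g x)
      = h\<^sup>2 * (e \<bullet> nderiv g [w, v] (x + s *\<^sub>R v + t *\<^sub>R w))"
proof -
  let ?\<phi> = "\<lambda>s. e \<bullet> g ((x + h *\<^sub>R w) + s *\<^sub>R v) - e \<bullet> g (x + s *\<^sub>R v)"
  have "\<exists>s>0. s < h \<and> ?\<phi> h - ?\<phi> 0 = (h - 0) *
      (e \<bullet> frechet_derivative g (at ((x + h *\<^sub>R w) + s *\<^sub>R v)) v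
         - e \<bullet> frechet_derivative g (at (x + s *\<^sub>R v)) v)"
    by (rule MVT2[OF h]) (intro DERIV_diff has_real_derivative_along_line g)
  then obtain s where s: "0 < s" "s < h"
    and eq1: "?\<phi> h - ?\<phi> 0 = h * (e \<bullet> nderiv g [v] ((x + s *\<^sub>R v) + h *\<^sub>R w)
         - e \<bullet> nderiv g [v] (x + s *\<^sub>R v))"
    by (auto simp: algebra_simps)
  let ?\<psi> = "\<lambda>t. e \<bullet> nderiv g [v] ((x + s *\<^sub>R v) + t *\<^sub>R w)"
  have "\<exists>t>0. t < h \<and> ?\<psi> h - ?\<psi> 0 = (h - 0) *
      (e \<bullet> frechet_derivative (nderiv g [v]) (at ((x + s *\<^sub>R v) + t *\<^sub>R w)) w)"
    by (rule MVT2[OF h]) (intro has_real_derivative_along_line gv)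
  then obtain t where t: "0 < t" "t < h"
    and eq2: "?\<psi> h - ?\<psi> 0 = h * (e \<bullet> nderiv g [w, v] (x + s *\<^sub>R v + t *\<^sub>R w))"
    by auto
  have "e \<bullet> (g (x + h *\<^sub>R v + h *\<^sub>R w) - g (x + h *\<^sub>R v) - g (x + h *\<^sub>R w) + g x) = ?\<phi> h - ?\<phi> 0"
    by (simp add: inner_diff_right inner_add_right algebra_simps)
  also have "\<dots> = h * (?\<psi> h - ?\<psi> 0)"
    using eq1 by simp
  also have "\<dots> = h\<^sup>2 * (e \<bullet> nderiv g [w, v] (x + s *\<^sub>R v + t *\<^sub>R w))"
    by (simp only: eq2 power2_eq_square mult.assoc)
  finally show ?thesis
    using s t by blast
qed

text \<open>
  The theorem of Schwarz: both mixed derivatives are limits of the same quotients of second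
  differences, divided by the area of the parallelogram.
\<close>

lemma nderiv_swap_two:
  fixes g :: "'a::euclidean_space \<Rightarrow> 'b::real_inner"
  assumes g: "\<And>x. g differentiable (at x)"
    and gv: "\<And>v x. nderiv g [v] differentiable (at x)"
    and cont: "\<And>v w. continuous_on UNIV (nderiv g [v, w])"
  shows "nderiv g [v, w] x = nderiv g [w, v] x"
proof -
  have lim: "(\<lambda>n. e \<bullet> nderiv g [a, b] (x + s n *\<^sub>R b + t n *\<^sub>R a)) \<longlonglongrightarrow> e \<bullet> nderiv g [a, b] x"
    if st: "\<And>n. 0 < s n \<and> s n < inverse (real (Suc n)) \<and> 0 < t n \<and> t n < inverse (real (Suc n))"
    for s t :: "nat \<Rightarrow> real" and a b e
  proof -
    have "s \<longlonglongrightarrow> 0" "t \<longlonglongrightarrow> 0"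
      by (rule real_tendsto_sandwich[OF _ _ tendsto_const LIMSEQ_inverse_real_of_nat];
          use st in \<open>auto intro!: always_eventually less_imp_le\<close>)+
    then have "(\<lambda>n. x + s n *\<^sub>R b + t n *\<^sub>R a) \<longlonglongrightarrow> x + 0 *\<^sub>R b + 0 *\<^sub>R a"
      by (intro tendsto_intros)
    moreover have "isCont (nderiv g [a, b]) (x + 0 *\<^sub>R b + 0 *\<^sub>R a)"
      using cont[of a b] by (simp only: continuous_on_eq_continuous_at[OF open_UNIV] ball_UNIV)
    ultimately have "(\<lambda>n. nderiv g [a, b] (x + s n *\<^sub>R b + t n *\<^sub>R a))
        \<longlonglongrightarrow> nderiv g [a, b] (x + 0 *\<^sub>R b + 0 *\<^sub>R a)"
      by (rule isCont_tendsto_compose[rotated])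
    then show ?thesis
      by (intro tendsto_inner tendsto_const) (simp del: nderiv.simps)
  qed
  have "e \<bullet> nderiv g [v, w] x = e \<bullet> nderiv g [w, v] x" for e
  proof -
    let ?h = "\<lambda>n. inverse (real (Suc n))"
    let ?\<Delta> = "\<lambda>n v w. e \<bullet> (g (x + ?h n *\<^sub>R v + ?h n *\<^sub>R w) - g (x + ?h n *\<^sub>R v) - g (x + ?h n *\<^sub>R w) + g x)"
    have quotient: "\<exists>z. (\<forall>n. ?\<Delta> n b a = (?h n)\<^sup>2 * z n) \<and> z \<longlonglongrightarrow> e \<bullet> nderiv g [a, b] x" for a b
    proof -
      have "\<forall>n. \<exists>s t. 0 < s \<and> s < ?h n \<and> 0 < t \<and> t < ?h n \<and>
          ?\<Delta> n b a = (?h n)\<^sup>2 * (e \<bullet> nderiv g [a, b] (x + s *\<^sub>R b + t *\<^sub>R a))"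
        by (intro allI second_difference_mean_value g gv) simp
      then obtain s t where st: "\<And>n. 0 < s n \<and> s n < ?h n \<and> 0 < t n \<and> t n < ?h n"
        and \<Delta>: "\<And>n. ?\<Delta> n b a = (?h n)\<^sup>2 * (e \<bullet> nderiv g [a, b] (x + s n *\<^sub>R b + t n *\<^sub>R a))"
        by metis
      show ?thesis
        by (intro exI conjI allI) (rule \<Delta>, rule lim[OF st])
    qed
    obtain z where z: "\<And>n. ?\<Delta> n w v = (?h n)\<^sup>2 * z n" "z \<longlonglongrightarrow> e \<bullet> nderiv g [v, w] x"
      using quotient[of w v] by blast
    obtain z' where z': "\<And>n. ?\<Delta> n v w = (?h n)\<^sup>2 * z' n" "z' \<longlonglongrightarrow> e \<bullet> nderiv g [w, v] x"
      using quotient[of v w] by blast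
    have "(?h n)\<^sup>2 * z n = (?h n)\<^sup>2 * z' n" for n
      unfolding z(1)[symmetric] z'(1)[symmetric] by (simp add: algebra_simps)
    then have "z = z'"
      by auto
    then show ?thesis
      using z(2) z'(2) LIMSEQ_unique by blast
  qed
  then show ?thesis
    by (subst vector_eq_rdot[symmetric]) (metis inner_commute)
qed

lemma nderiv_nderiv: "nderiv (nderiv f vs) ws = nderiv f (ws @ vs)"
  by (induction ws) simp_all

lemma Cb_differentiable: "Cb k f \<Longrightarrow> length vs < k \<Longrightarrow> nderiv f vs differentiable (at x)"
  by (simp add: Cb_def)

lemma Cb_continuous: "Cb k f \<Longrightarrow> length vs \<le> k \<Longrightarrow> continuous_on UNIV (nderiv f vs)"
  by (simp add: Cb_def)

lemma Cb_bounded: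
  "Cb k f \<Longrightarrow> j \<le> k \<Longrightarrow> \<exists>b. \<forall>vs x. length vs = j \<longrightarrow> norm (nderiv f vs x) \<le> b * (\<Prod>v\<leftarrow>vs. norm v)"
  by (simp add: Cb_def)

lemma Cb_mono: "Cb k f \<Longrightarrow> l \<le> k \<Longrightarrow> Cb l f"
  unfolding Cb_def by (auto dest: order.strict_trans2 order.trans)

lemma nderiv_Cons_swap:
  fixes f :: "'a::euclidean_space \<Rightarrow> 'b::real_inner"
  assumes "Cb k f" and "length vs + 2 \<le> k"
  shows "nderiv f (v # w # vs) = nderiv f (w # v # vs)"
proof
  fix x
  have "nderiv (nderiv f vs) [v, w] x = nderiv (nderiv f vs) [w, v] x"
    using assms 
    by (intro nderiv_swap_two)
       (simp_all add: nderiv_nderiv Cb_differentiable Cb_continuous del: nderiv.simps)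
  then show "nderiv f (v # w # vs) x = nderiv f (w # v # vs) x"
    by simp
qed

text \<open>
  Together with the definition of \<open>nderiv\<close> by recursion on the list of directions, moving one
  direction to the front is enough to realise every permutation of the directions.
\<close>

lemma nderiv_move_to_front:
  fixes f :: "'a::euclidean_space \<Rightarrow> 'b::real_inner"
  assumes "Cb k f" and "length us + length vs < k"
  shows "nderiv f (us @ v # vs) = nderiv f (v # us @ vs)"
  using assms(2)
proof (induction us)
  case (Cons u us)
  then have "nderiv f ((u # us) @ v # vs) = nderiv f (u # v # us @ vs)"
    by simp
  also have "\<dots> = nderiv f (v # u # us @ vs)"
    using Cons.prems by (intro nderiv_Cons_swap[OF assms(1)]) simp
  finally show ?case by simp
qed simp

lemma nderiv_mset_cong:
  fixes f :: "'a::euclidean_space \<Rightarrow> 'b::real_inner"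
  assumes "Cb k f" and "mset vs = mset ws" and "length vs \<le> k"
  shows "nderiv f vs = nderiv f ws"
  using assms(2,3)
proof (induction vs arbitrary: ws)
  case (Cons v vs)
  from Cons.prems(1) have "v \<in> set ws"
    by (metis list.set_intros(1) set_mset_mset)
  then obtain xs ys where ws: "ws = xs @ v # ys"
    by (meson split_list)
  with Cons.prems(1) have mset: "mset vs = mset (xs @ ys)"
    by simp
  then have "length vs = length xs + length ys"
    by (metis length_append size_mset)
  with Cons.prems(2) have "nderiv f ws = nderiv f (v # xs @ ys)"
    unfolding ws by (intro nderiv_move_to_front[OF assms(1)]) simp
  also have "\<dots> = nderiv f (v # vs)"
    using Cons.IH[OF mset] Cons.prems(2) by simp
  finally show ?case by simp
qed simp

section \<open>Multilinearity and the Taylor bound\<close>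

text \<open>
  The functional induction hypothesis can be differentiated, so multilinearity in all directions
  at once follows from linearity of each derivative in its own direction.
\<close>

lemma nderiv_scaleR:
  assumes "Cb k f" and "length is \<le> k"
  shows "nderiv f (map (\<lambda>i. c i *\<^sub>R w i) is) x = (\<Prod>i\<leftarrow>is. c i) *\<^sub>R nderiv f (map w is) x"
  using assms(2)
proof (induction "is" arbitrary: x)
  case (Cons i "is")
  let ?G = "nderiv f (map w is)" and ?C = "\<Prod>i\<leftarrow>is. c i"
  have G: "?G differentiable (at x)"
    using Cons.prems by (intro Cb_differentiable[OF assms(1)]) simp
  have IH: "nderiv f (map (\<lambda>i. c i *\<^sub>R w i) is) = (\<lambda>x. ?C *\<^sub>R ?G x)"
    using Cons by fastforce
  have "((\<lambda>x. ?C *\<^sub>R ?G x) has_derivative (\<lambda>v. ?C *\<^sub>R frechet_derivative ?G (at x) v)) (at x)"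
    using G by (intro derivative_intros) (simp add: frechet_derivative_works)
  then have "frechet_derivative (\<lambda>x. ?C *\<^sub>R ?G x) (at x) = (\<lambda>v. ?C *\<^sub>R frechet_derivative ?G (at x) v)"
    by (rule frechet_derivative_at[symmetric])
  then show ?case
    using linear_cmul[OF linear_frechet_derivative[OF G]] by (simp add: IH mult.commute)
qed simp

text \<open>
  The multinomial expansion of \<open>D\<^sup>nf(x)[S, \<dots>, S]\<close> for a sum \<open>S\<close>, in its noncommutative form: one
  term for every list of \<open>n\<close> summands. The lists are only identified up to permutation later on.
\<close>

lemma nderiv_replicate_sum:
  assumes "Cb k f" and "finite A" and "n \<le> k"
  shows "nderiv f (replicate n (\<Sum>i\<in>A. g i)) x
    = (\<Sum>is | set is \<subseteq> A \<and> length is = n. nderiv f (map g is) x)"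
  using assms(3)
proof (induction n arbitrary: x)
  case 0
  have "{is. set is \<subseteq> A \<and> length is = 0} = {[]}"
    by auto
  then show ?case by simp
next
  case (Suc n)
  let ?L = "\<lambda>n. {is. set is \<subseteq> A \<and> length is = n}" and ?S = "\<Sum>i\<in>A. g i"
  have IH: "nderiv f (replicate n ?S) = (\<lambda>x. \<Sum>is\<in>?L n. nderiv f (map g is) x)"
    using Suc by fastforce
  have D: "nderiv f (map g is) differentiable (at x)" if "is \<in> ?L n" for "is"
    using Suc.prems that by (intro Cb_differentiable[OF assms(1)]) simp
  have "((\<lambda>x. \<Sum>is\<in>?L n. nderiv f (map g is) x) has_derivative
      (\<lambda>v. \<Sum>is\<in>?L n. frechet_derivative (nderiv f (map g is)) (at x) v)) (at x)"
    using D by (intro derivative_intros) (simp add: frechet_derivative_works)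
  then have "nderiv f (replicate (Suc n) ?S) x
      = (\<Sum>is\<in>?L n. frechet_derivative (nderiv f (map g is)) (at x) ?S)"
    by (simp add: IH frechet_derivative_at[symmetric])
  also have "\<dots> = (\<Sum>is\<in>?L n. \<Sum>i\<in>A. nderiv f (map g (i # is)) x)"
    using D by (intro sum.cong refl) (simp add: linear_sum[OF linear_frechet_derivative])
  also have "\<dots> = (\<Sum>(is, i)\<in>?L n \<times> A. nderiv f (map g (i # is)) x)"
    by (simp add: sum.cartesian_product)
  also have "\<dots> = (\<Sum>is\<in>?L (Suc n). nderiv f (map g is) x)"
    by (rule sum.reindex_bij_witness[where i = "\<lambda>is. (tl is, hd is)" and j = "\<lambda>(is, i). i # is"])
       (auto simp: length_Suc_conv simp del: nderiv.simps)
  finally show ?case .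
qed

text \<open>
  The Taylor polynomial along the segment from \<open>x\<close> to \<open>x + d\<close>. Pairing with the unit vector in the
  direction of the remainder reduces the estimate to the Lagrange remainder of a real function.
\<close>

lemma Cb_Taylor_bound:
  fixes f :: "'a::euclidean_space \<Rightarrow> 'b::real_inner"
  assumes "Cb (Suc k) f"
  shows "\<exists>B\<ge>0. \<forall>x d. norm (f (x + d) - (\<Sum>n\<le>k. (1 / fact n) *\<^sub>R nderiv f (replicate n d) x))
           \<le> B * norm d ^ Suc k"
proof -
  from assms obtain B where B: "\<And>vs x. length vs = Suc k \<Longrightarrow> norm (nderiv f vs x) \<le> B * (\<Prod>v\<leftarrow>vs. norm v)"
    unfolding Cb_def by blast
  have "norm (f (x + d) - (\<Sum>n\<le>k. (1 / fact n) *\<^sub>R nderiv f (replicate n d) x)) \<le> \<bar>B\<bar> * norm d ^ Suc k"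
    (is "norm ?r \<le> _") for x d
  proof -
    define e where "e = sgn ?r"
    let ?diff = "\<lambda>n t. e \<bullet> nderiv f (replicate n d) (x + t *\<^sub>R d)"
    have "\<forall>n t. n < Suc k \<and> 0 \<le> t \<and> t \<le> 1 \<longrightarrow> (?diff n has_real_derivative ?diff (Suc n) t) (at t)"
      using has_real_derivative_along_line[OF Cb_differentiable[OF assms]] by simp
    from Maclaurin[OF zero_less_one zero_less_Suc refl this] obtain t where
      "?diff 0 1 = (\<Sum>n<Suc k. ?diff n 0 / fact n * 1 ^ n) + ?diff (Suc k) t / fact (Suc k) * 1 ^ Suc k"
      by blast
    then have eq: "e \<bullet> ?r = ?diff (Suc k) t / fact (Suc k)"
      by (simp add: inner_diff_right inner_sum_right lessThan_Suc_atMost del: nderiv.simps(2) fact_Suc)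
    have "e \<bullet> ?r = norm ?r"
      unfolding e_def sgn_div_norm by (cases "?r = 0") (simp_all add: dot_square_norm power2_eq_square)
    then have "norm ?r \<le> \<bar>?diff (Suc k) t\<bar> / fact (Suc k)"
      unfolding eq by (metis abs_divide abs_ge_self abs_of_nonneg fact_ge_zero)
    also have "\<dots> \<le> \<bar>?diff (Suc k) t\<bar>"
      using divide_left_mono[OF fact_ge_1[of "Suc k"], of "\<bar>?diff (Suc k) t\<bar>"] by (simp del: nderiv.simps fact_Suc)
    also have "\<dots> \<le> norm e * norm (nderiv f (replicate (Suc k) d) (x + t *\<^sub>R d))"
      by (rule Cauchy_Schwarz_ineq2)
    also have "\<dots> \<le> 1 * (B * norm d ^ Suc k)"
      using B[of "replicate (Suc k) d" "x + t *\<^sub>R d"]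
      by (intro mult_mono) (auto simp: e_def norm_sgn)
    also have "\<dots> \<le> \<bar>B\<bar> * norm d ^ Suc k"
      by (simp add: mult_right_mono)
    finally show ?thesis .
  qed
  then show ?thesis
    by (intro exI[of _ "\<bar>B\<bar>"]) simp
qed

section \<open>Taylor expansion indexed by multisets\<close>

text \<open>
  \<open>D\<^sup>nf(x)\<close> evaluated on a multiset of directions, with the same arbitrary ordering as in
  \<open>elem_diff\<close>.
\<close>

definition mderiv :: "('a::euclidean_space \<Rightarrow> 'b::real_normed_vector) \<Rightarrow> 'a multiset \<Rightarrow> 'a \<Rightarrow> 'b"
  where "mderiv f V x = nderiv f (SOME vs. mset vs = V) x"

lemma mderiv_mset:
  fixes f :: "'a::euclidean_space \<Rightarrow> 'b::real_inner"
  assumes "Cb k f" and "length vs \<le> k"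
  shows "mderiv f (mset vs) x = nderiv f vs x"
proof -
  have "mset (SOME ws. mset ws = mset vs) = mset vs"
    by (rule someI_ex) auto
  then have "nderiv f vs = nderiv f (SOME ws. mset ws = mset vs)"
    using assms by (intro nderiv_mset_cong) auto
  then show ?thesis
    by (simp add: mderiv_def)
qed

lemma elem_diff_Node:
  "elem_diff F (Node a M) y = mderiv (F a) (image_mset (\<lambda>\<tau>. elem_diff F \<tau> y) M) y"
  by (simp add: mderiv_def multiset.map_comp comp_def)

lemma mderiv_scaleR:
  fixes f :: "'a::euclidean_space \<Rightarrow> 'b::real_inner"
  assumes "Cb k f" and "size M \<le> k"
  shows "mderiv f (image_mset (\<lambda>i. c i *\<^sub>R w i) M) x = (\<Prod>i\<in>#M. c i) *\<^sub>R mderiv f (image_mset w M) x"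
proof -
  obtain "is" where M: "M = mset is"
    by (metis ex_mset)
  then show ?thesis
    using assms(2) nderiv_scaleR[OF assms(1), of "is" c w x]
    by (simp add: mderiv_mset[OF assms(1)] prod_mset_prod_list flip: mset_map)
qed

text \<open>
  A multiset \<open>M\<close> is the content of \<open>n! / \<Prod>\<^sub>i m\<^sub>i!\<close> lists, where \<open>n\<close> is its size and \<open>m\<^sub>i\<close> are its
  multiplicities. The factor \<open>1 / n!\<close> of the Taylor polynomial therefore becomes \<open>1 / \<Prod>\<^sub>i m\<^sub>i!\<close>, the
  local part of the symmetry factor of a tree.
\<close>

lemma sum_lists_by_mset:
  fixes X :: "'i multiset \<Rightarrow> 'b::real_vector"
  assumes "finite \<M>"
  shows "(\<Sum>is | mset is \<in> \<M>. (1 / fact (length is)) *\<^sub>R X (mset is))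
    = (\<Sum>M\<in>\<M>. (1 / (\<Prod>i\<in>set_mset M. fact (count M i))) *\<^sub>R X M)"
proof -
  have "{is. mset is \<in> \<M>} = (\<Union>M\<in>\<M>. permutations_of_multiset M)"
    by (auto simp: permutations_of_multiset_def)
  then have "(\<Sum>is | mset is \<in> \<M>. (1 / fact (length is)) *\<^sub>R X (mset is))
      = (\<Sum>M\<in>\<M>. \<Sum>is\<in>permutations_of_multiset M. (1 / fact (length is)) *\<^sub>R X (mset is))"
    using assms
    by (simp only:) (intro sum.UNION_disjoint, auto dest: permutations_of_multisetD)
  also have "\<dots> = (\<Sum>M\<in>\<M>. (1 / (\<Prod>i\<in>set_mset M. fact (count M i))) *\<^sub>R X M)"
  proof (intro sum.cong refl)
    fix M :: "'i multiset"
    have "(\<Sum>is\<in>permutations_of_multiset M. (1 / fact (length is)) *\<^sub>R X (mset is))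
        = (\<Sum>is\<in>permutations_of_multiset M. (1 / fact (size M)) *\<^sub>R X M)"
      by (intro sum.cong refl) (auto simp: permutations_of_multiset_def)
    also have "\<dots> = (real (card (permutations_of_multiset M)) / fact (size M)) *\<^sub>R X M"
      by (simp add: scaleR_sum_left[symmetric] del: scaleR_sum_left)
    also have "real (card (permutations_of_multiset M)) / fact (size M)
        = 1 / (\<Prod>i\<in>set_mset M. fact (count M i))"
    proof -
      have "real (card (permutations_of_multiset M)) * (\<Prod>i\<in>set_mset M. fact (count M i)) = fact (size M)"
        using arg_cong[OF card_permutations_of_multiset_aux[of M], of real] by simp
      moreover have "(\<Prod>i\<in>set_mset M. fact (count M i) :: real) \<noteq> 0"
        by simp
      ultimately show ?thesis
        by (simp add: field_simps)
    qed
    finally show "(\<Sum>is\<in>permutations_of_multiset M. (1 / fact (length is)) *\<^sub>R X (mset is))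
        = (1 / (\<Prod>i\<in>set_mset M. fact (count M i))) *\<^sub>R X M" .
  qed
  finally show ?thesis .
qed

text \<open>
  A multi-index over \<open>A\<close> is encoded as a multiset, the multiplicity of \<open>i\<close> being the exponent at \<open>i\<close>;
  for trees with the number of vertices as weight it is a forest.
\<close>

definition multi_indices :: "'i set \<Rightarrow> ('i \<Rightarrow> nat) \<Rightarrow> nat \<Rightarrow> 'i multiset set"
  where "multi_indices A w k = {M. set_mset M \<subseteq> A \<and> (\<Sum>i\<in>#M. w i) \<le> k}"

lemma size_le_total_weight:
  assumes "\<And>i. i \<in># M \<Longrightarrow> w i \<ge> 1"
  shows "size M \<le> (\<Sum>i\<in>#M. w i :: nat)"
  using assms
proof (induction M)
  case (add i M)
  then have "size M \<le> (\<Sum>i\<in>#M. w i)" "1 \<le> w i"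
    by auto
  then show ?case by simp
qed simp

lemma finite_multi_indices:
  assumes "finite A" and "\<And>i. i \<in> A \<Longrightarrow> w i \<ge> 1"
  shows "finite (multi_indices A w k)"
proof -
  have "multi_indices A w k \<subseteq> mset ` {is. set is \<subseteq> A \<and> length is \<le> k}"
  proof
    fix M assume M: "M \<in> multi_indices A w k"
    obtain "is" where "M = mset is"
      by (metis ex_mset)
    then show "M \<in> mset ` {is. set is \<subseteq> A \<and> length is \<le> k}"
      using M size_le_total_weight[of M w] assms(2) by (fastforce simp: multi_indices_def)
  qed
  then show ?thesis
    using finite_lists_length_le[OF assms(1)] finite_surj by blast
qed

lemma prod_norm_graded_le:
  fixes g :: "'i \<Rightarrow> 'a::real_normed_vector"
  assumes "\<And>i. i \<in> set is \<Longrightarrow> norm (g i) \<le> G * h ^ w i" and "0 \<le> G" and "0 \<le> h"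
  shows "(\<Prod>v\<leftarrow>map g is. norm v) \<le> G ^ length is * h ^ (\<Sum>i\<leftarrow>is. w i)"
  using assms(1)
proof (induction "is")
  case (Cons i "is")
  have "norm (g i) * (\<Prod>v\<leftarrow>map g is. norm v) \<le> (G * h ^ w i) * (G ^ length is * h ^ (\<Sum>i\<leftarrow>is. w i))"
    using Cons assms by (intro mult_mono) (auto intro!: prod_list_nonneg)
  then show ?case
    by (simp add: power_add mult_ac)
qed simp

text \<open>
  Excess powers of the small parameter are absorbed into constants by means of the bound \<open>H\<close>, so that
  \<open>h\<close> may exceed \<open>1\<close>.
\<close>

lemma power_le_power_mult:
  fixes h H :: real
  assumes "0 \<le> h" and "h \<le> H" and "m \<le> n"
  shows "h ^ n \<le> H ^ (n - m) * h ^ m"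
proof -
  have "h ^ n = h ^ (n - m) * h ^ m"
    using assms(3) by (simp flip: power_add)
  also have "\<dots> \<le> H ^ (n - m) * h ^ m"
    using assms by (intro mult_right_mono power_mono) auto
  finally show ?thesis .
qed

text \<open>
  The Taylor expansion around \<open>y\<close> when the increment is a finite sum of terms \<open>g i\<close> of orders
  \<open>h ^ w i\<close>. Expanding the Taylor polynomial of degree \<open>k\<close> multilinearly gives one term for each list
  of indices. As every weight is at least \<open>1\<close>, lists longer than \<open>k\<close> would have total weight above
  \<open>k\<close> anyway; hence the lists of total weight at most \<open>k\<close> all occur and sum to the stated multi-index
  sum, while the finitely many others are \<open>O(h ^ (k + 1))\<close>. The constant is uniform in \<open>h\<close>, \<open>g\<close>
  and \<open>y\<close>.
\<close>

lemma Taylor_multi_index: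
  fixes f :: "'a::euclidean_space \<Rightarrow> 'b::real_inner" and w :: "'i \<Rightarrow> nat" and G H :: real
  assumes f: "Cb (Suc k) f" and A: "finite A" and w: "\<And>i. i \<in> A \<Longrightarrow> w i \<ge> 1" and "G \<ge> 0" and "H \<ge> 0"
  shows "\<exists>K\<ge>0. \<forall>h g y. 0 \<le> h \<and> h \<le> H \<and> (\<forall>i\<in>A. norm (g i) \<le> G * h ^ w i) \<longrightarrow>
    norm (f (y + (\<Sum>i\<in>A. g i)) - (\<Sum>M\<in>multi_indices A w k.
        (1 / (\<Prod>i\<in>set_mset M. fact (count M i))) *\<^sub>R mderiv f (image_mset g M) y)) \<le> K * h ^ Suc k"
proof -
  obtain B where B0: "B \<ge> 0"
    and B: "\<And>y d. norm (f (y + d) - (\<Sum>n\<le>k. (1 / fact n) *\<^sub>R nderiv f (replicate n d) y)) \<le> B * norm d ^ Suc k"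
    using Cb_Taylor_bound[OF f] by blast
  have "\<forall>j. \<exists>b. j \<le> Suc k \<longrightarrow> (\<forall>vs x. length vs = j \<longrightarrow> norm (nderiv f vs x) \<le> b * (\<Prod>v\<leftarrow>vs. norm v))"
    using Cb_bounded[OF f] by (intro allI) (auto simp only: ex_simps)
  then obtain b where b': "\<forall>j. j \<le> Suc k \<longrightarrow>
      (\<forall>vs x. length vs = j \<longrightarrow> norm (nderiv f vs x) \<le> b j * (\<Prod>v\<leftarrow>vs. norm v))"
    by (rule exE[OF choice])
  have b: "norm (nderiv f vs x) \<le> b (length vs) * (\<Prod>v\<leftarrow>vs. norm v)" if "length vs \<le> Suc k" for vs x
    using b' that by blast
  \<comment> \<open>\<open>D * h\<close> bounds the increment, and \<open>hi\<close> collects the lists that are too heavy for the expansion.\<close>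
  define D where "D = (\<Sum>i\<in>A. G * H ^ (w i - 1))"
  let ?W = "\<lambda>is. \<Sum>i\<leftarrow>is. w i"
  define L where "L = {is. set is \<subseteq> A \<and> length is \<le> k}"
  define hi where "hi = {is \<in> L. ?W is > k}"
  define lo where "lo = {is. mset is \<in> multi_indices A w k}"
  define K where "K = B * D ^ Suc k + (\<Sum>is\<in>hi. \<bar>b (length is)\<bar> * (G ^ length is * H ^ (?W is - Suc k)))"
  have L: "finite L"
    unfolding L_def using A by (rule finite_lists_length_le)
  have W: "(\<Sum>i\<in>#mset is. w i) = ?W is" for "is"
    by (induction "is") simp_all
  have len: "length is \<le> k" if "set is \<subseteq> A" "?W is \<le> k" for "is"
  proof -
    have "length is \<le> ?W is"
      using size_le_total_weight[of "mset is" w] w that(1) by (simp add: W subset_iff)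
    then show ?thesis
      using that(2) by simp
  qed
  have lo_eq: "lo = {is. set is \<subseteq> A \<and> ?W is \<le> k}"
    by (simp add: lo_def multi_indices_def W)
  have split: "L = lo \<union> hi" "lo \<inter> hi = {}"
    unfolding lo_eq hi_def L_def using len by (auto simp: not_less)
  have "norm (f (y + (\<Sum>i\<in>A. g i)) - (\<Sum>M\<in>multi_indices A w k.
        (1 / (\<Prod>i\<in>set_mset M. fact (count M i))) *\<^sub>R mderiv f (image_mset g M) y)) \<le> K * h ^ Suc k"
    if h: "0 \<le> h" "h \<le> H" and g: "\<forall>i\<in>A. norm (g i) \<le> G * h ^ w i" for h g y
  proof -
    let ?d = "\<Sum>i\<in>A. g i" and ?X = "\<lambda>is. (1 / fact (length is)) *\<^sub>R nderiv f (map g is) y"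
    have "(\<Sum>n\<le>k. (1 / fact n) *\<^sub>R nderiv f (replicate n ?d) y)
        = (\<Sum>n\<le>k. \<Sum>is | set is \<subseteq> A \<and> length is = n. ?X is)"
      by (intro sum.cong refl) (simp add: nderiv_replicate_sum[OF f A] scaleR_sum_right)
    also have "\<dots> = (\<Sum>n\<le>k. \<Sum>is | is \<in> L \<and> length is = n. ?X is)"
      by (intro sum.cong refl) (auto simp: L_def)
    also have "\<dots> = (\<Sum>is\<in>L. ?X is)"
      using L by (rule sum.group) (auto simp: L_def)
    also have "\<dots> = (\<Sum>is\<in>lo. ?X is) + (\<Sum>is\<in>hi. ?X is)"
      using L split(2) unfolding split(1) by (intro sum.union_disjoint) auto
    also have "(\<Sum>is\<in>lo. ?X is)
        = (\<Sum>is\<in>lo. (1 / fact (length is)) *\<^sub>R mderiv f (image_mset g (mset is)) y)"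
    proof (intro sum.cong refl arg_cong2[where f = scaleR])
      fix "is" assume "is \<in> lo"
      then have "length is \<le> k"
        using split by (auto simp: L_def)
      then show "nderiv f (map g is) y = mderiv f (image_mset g (mset is)) y"
        by (simp add: mderiv_mset[OF f] flip: mset_map)
    qed
    also have "\<dots> = (\<Sum>M\<in>multi_indices A w k.
        (1 / (\<Prod>i\<in>set_mset M. fact (count M i))) *\<^sub>R mderiv f (image_mset g M) y)"
      unfolding lo_def using finite_multi_indices[OF A w] by (rule sum_lists_by_mset)
    finally have "f (y + ?d) - (\<Sum>M\<in>multi_indices A w k.
          (1 / (\<Prod>i\<in>set_mset M. fact (count M i))) *\<^sub>R mderiv f (image_mset g M) y)
        = (f (y + ?d) - (\<Sum>n\<le>k. (1 / fact n) *\<^sub>R nderiv f (replicate n ?d) y)) + (\<Sum>is\<in>hi. ?X is)"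
      by simp
    also have "norm \<dots> \<le> B * norm ?d ^ Suc k + (\<Sum>is\<in>hi. norm (?X is))"
      by (intro norm_triangle_mono B norm_sum)
    also have "\<dots> \<le> B * (D * h) ^ Suc k
        + (\<Sum>is\<in>hi. \<bar>b (length is)\<bar> * (G ^ length is * (H ^ (?W is - Suc k) * h ^ Suc k)))"
    proof (intro add_mono mult_left_mono power_mono sum_mono)
      have "norm ?d \<le> (\<Sum>i\<in>A. G * h ^ w i)"
        using g by (intro sum_norm_le) simp
      also have "\<dots> \<le> (\<Sum>i\<in>A. G * (H ^ (w i - 1) * h ^ 1))"
        using h w \<open>G \<ge> 0\<close> by (intro sum_mono mult_left_mono power_le_power_mult) auto
      finally show "norm ?d \<le> D * h"
        by (simp add: D_def sum_distrib_right mult.assoc)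
    next
      fix "is" assume "is \<in> hi"
      then have "is": "set is \<subseteq> A" "length is \<le> k" "Suc k \<le> ?W is"
        unfolding hi_def L_def by simp_all
      have "norm (?X is) \<le> 1 * norm (nderiv f (map g is) y)"
        unfolding norm_scaleR by (intro mult_right_mono norm_ge_zero) simp
      also have "\<dots> \<le> \<bar>b (length is)\<bar> * (\<Prod>v\<leftarrow>map g is. norm v)"
      proof -
        have "norm (nderiv f (map g is) y) \<le> b (length is) * (\<Prod>v\<leftarrow>map g is. norm v)"
          using b[of "map g is" y] "is"(2) by simp
        also have "\<dots> \<le> \<bar>b (length is)\<bar> * (\<Prod>v\<leftarrow>map g is. norm v)"
          by (intro mult_right_mono abs_ge_self prod_list_nonneg) auto
        finally show ?thesis
          by simp
      qed
      also have "\<dots> \<le> \<bar>b (length is)\<bar> * (G ^ length is * h ^ ?W is)"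
        using g "is" h \<open>G \<ge> 0\<close> by (intro mult_left_mono prod_norm_graded_le) auto
      also have "\<dots> \<le> \<bar>b (length is)\<bar> * (G ^ length is * (H ^ (?W is - Suc k) * h ^ Suc k))"
        using "is"(3) h \<open>G \<ge> 0\<close>
        by (intro mult_left_mono power_le_power_mult abs_ge_zero zero_le_power)
      finally show "norm (?X is) \<le> \<dots>" .
    qed (use B0 in auto)
    also have "\<dots> = K * h ^ Suc k"
      by (simp add: K_def power_mult_distrib distrib_right sum_distrib_right mult.assoc)
    finally show ?thesis .
  qed
  moreover have "K \<ge> 0"
    unfolding K_def D_def using B0 \<open>G \<ge> 0\<close> \<open>H \<ge> 0\<close>
    by (intro add_nonneg_nonneg mult_nonneg_nonneg sum_nonneg zero_le_power) auto
  ultimately show ?thesis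
    by blast
qed

section \<open>Trees, their coefficients and elementary differentials\<close>

abbreviation forests_upto :: "nat \<Rightarrow> 'a tree multiset set"
  where "forests_upto k \<equiv> multi_indices (trees_upto k) vertices k"

lemma vertices_pos: "vertices \<tau> \<ge> 1"
  by (cases \<tau>) simp

text \<open>
  The forests that \<open>Taylor_multi_index\<close> produces from trees with at most \<open>k\<close> vertices become, once a
  root is added, exactly the trees with at most \<open>k + 1\<close> vertices.
\<close>

lemma trees_upto_Suc: "trees_upto (Suc k) = (\<lambda>(a, M). Node a M) ` (UNIV \<times> forests_upto k)"
proof (intro equalityI subsetI)
  fix \<tau> :: "'a tree" assume \<tau>: "\<tau> \<in> trees_upto (Suc k)"
  obtain a M where N: "\<tau> = Node a M"
    by (cases \<tau>)
  with \<tau> have "vertices (Node a M) \<le> Suc k"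
    by (simp add: trees_upto_def)
  moreover from this have "set_mset M \<subseteq> trees_upto k"
    using vertices_child_less[of _ M a] by (force simp: trees_upto_def simp del: vertices.simps)
  ultimately show "\<tau> \<in> (\<lambda>(a, M). Node a M) ` (UNIV \<times> forests_upto k)"
    by (auto simp: N multi_indices_def)
qed (auto simp: trees_upto_def multi_indices_def)

lemma sum_trees_upto_Suc:
  fixes X :: "'m::finite tree \<Rightarrow> 'b::comm_monoid_add"
  shows "(\<Sum>\<tau>\<in>trees_upto (Suc k). X \<tau>) = (\<Sum>a\<in>UNIV. \<Sum>M\<in>forests_upto k. X (Node a M))"
proof -
  have "inj_on (\<lambda>(a, M). Node a M) (UNIV \<times> forests_upto k :: ('m \<times> 'm tree multiset) set)"
    by (auto simp: inj_on_def)
  then show ?thesis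
    by (simp add: trees_upto_Suc sum.reindex sum.cartesian_product case_prod_beta' comp_def)
qed

lemma prod_mset_component: "(\<Prod>\<tau>\<in>#M. x \<tau> :: real ^ 'q) $ j = (\<Prod>\<tau>\<in>#M. x \<tau> $ j)"
  by (induction M) simp_all

text \<open>
  A stage is itself a step whose weights are a row of \<open>Z\<close>. For this reason one estimate,
  \<open>crk_map_expansion\<close>, serves both the stages and the final step.
\<close>

lemma stage_coeff_eq_step_coeff: "stage_coeff Z \<tau> $ i = step_coeff Z (\<lambda>a. Z a $ i) \<tau>"
  by (cases \<tau>) (simp add: matrix_vector_mul_component)

lemma step_coeff_Node:
  "step_coeff Z z (Node a M) = (\<Sum>j\<in>UNIV. z a $ j * (\<Prod>\<tau>\<in>#M. stage_coeff Z \<tau> $ j))"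
  by (simp add: inner_vec_def prod_mset_component)

text \<open>
  Each vertex contributes one matrix-vector product, hence one factor \<open>q c\<close>. Thus the coefficient of
  \<open>\<tau>\<close> has the order \<open>c ^ vertices \<tau>\<close>, the grading required by \<open>Taylor_multi_index\<close>.
\<close>

lemma abs_stage_coeff_le:
  fixes Z :: "'a \<Rightarrow> real ^ 'q ^ 'q"
  assumes Z: "\<And>a i j. \<bar>Z a $ i $ j\<bar> \<le> c"
  shows "\<bar>stage_coeff Z \<tau> $ i\<bar> \<le> (real CARD('q) * c) ^ vertices \<tau>"
proof (induction \<tau> arbitrary: i)
  case (Node a M)
  let ?h = "real CARD('q) * c"
  have c: "0 \<le> c"
    using Z order.trans abs_ge_zero by blast
  have prod: "\<bar>\<Prod>\<tau>\<in>#M. stage_coeff Z \<tau> $ j\<bar> \<le> ?h ^ (\<Sum>\<tau>\<in>#M. vertices \<tau>)" for j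
    using Node
  proof (induction M)
    case (add \<tau> M)
    then have "\<bar>stage_coeff Z \<tau> $ j\<bar> * \<bar>\<Prod>\<tau>\<in>#M. stage_coeff Z \<tau> $ j\<bar>
        \<le> ?h ^ vertices \<tau> * ?h ^ (\<Sum>\<tau>\<in>#M. vertices \<tau>)"
      using c by (intro mult_mono) auto
    then show ?case
      by (simp add: power_add abs_mult)
  qed simp
  have "\<bar>stage_coeff Z (Node a M) $ i\<bar> \<le> (\<Sum>j\<in>UNIV. \<bar>Z a $ i $ j\<bar> * \<bar>\<Prod>\<tau>\<in>#M. stage_coeff Z \<tau> $ j\<bar>)"
    unfolding stage_coeff_eq_step_coeff step_coeff_Node abs_mult[symmetric] by (rule sum_abs)
  also have "\<dots> \<le> (\<Sum>j\<in>(UNIV :: 'q set). c * ?h ^ (\<Sum>\<tau>\<in>#M. vertices \<tau>))"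
    using c by (intro sum_mono mult_mono Z prod) auto
  also have "\<dots> = ?h ^ vertices (Node a M)"
    by simp
  finally show ?case .
qed

text \<open>
  The multiplicities of the Taylor expansion and the symmetry factors of the subtrees combine into
  the symmetry factor of the tree.
\<close>

lemma inverse_symmetry_Node:
  "(\<Prod>\<tau>\<in>#M. x \<tau> / real (symmetry \<tau>)) / (\<Prod>\<tau>\<in>set_mset M. fact (count M \<tau>))
    = (\<Prod>\<tau>\<in>#M. x \<tau>) / real (symmetry (Node a M))"
proof -
  have "(\<Prod>\<tau>\<in>#M. x \<tau> / real (symmetry \<tau>)) = (\<Prod>\<tau>\<in>#M. x \<tau>) / (\<Prod>\<tau>\<in>#M. real (symmetry \<tau>))"
    by (induction M) simp_all
  also have "(\<Prod>\<tau>\<in>#M. real (symmetry \<tau>)) = (\<Prod>\<tau>\<in>set_mset M. real (symmetry \<tau>) ^ count M \<tau>)"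
    by (rule image_prod_mset_multiplicity)
  finally show ?thesis
    by (simp add: prod.distrib mult.commute)
qed

lemma elem_diff_bounded:
  fixes F :: "'a \<Rightarrow> 'b::euclidean_space \<Rightarrow> 'b"
  assumes F: "\<And>a. Cb k (F a)" and "vertices \<tau> \<le> Suc k"
  shows "\<exists>E. \<forall>y. norm (elem_diff F \<tau> y) \<le> E"
  using assms(2)
proof (induction \<tau>)
  case (Node a M)
  have "\<exists>E. \<forall>y. norm (elem_diff F \<tau> y) \<le> E" if "\<tau> \<in># M" for \<tau>
    using Node vertices_child_less[OF that, of a] that by (metis order.strict_implies_order order.trans)
  then obtain E where E: "\<And>\<tau> y. \<tau> \<in># M \<Longrightarrow> norm (elem_diff F \<tau> y) \<le> E \<tau>"
    by metis
  obtain "is" where M: "M = mset is"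
    by (metis ex_mset)
  have "size M \<le> (\<Sum>\<tau>\<in>#M. vertices \<tau>)"
    using vertices_pos by (rule size_le_total_weight)
  then have len: "length is \<le> k"
    using Node.prems by (simp add: M)
  then obtain b where b: "\<And>vs y. length vs = length is \<Longrightarrow> norm (nderiv (F a) vs y) \<le> b * (\<Prod>v\<leftarrow>vs. norm v)"
    using Cb_bounded[OF F] by blast
  have "norm (elem_diff F (Node a M) y) \<le> \<bar>b\<bar> * (\<Prod>\<tau>\<leftarrow>is. E \<tau>)" for y
  proof -
    let ?vs = "map (\<lambda>\<tau>. elem_diff F \<tau> y) is"
    have nn: "0 \<le> (\<Prod>v\<leftarrow>?vs. norm v)"
      by (intro prod_list_nonneg) auto
    have "set is \<subseteq> set_mset M"
      by (simp add: M)
    then have le: "(\<Prod>v\<leftarrow>?vs. norm v) \<le> (\<Prod>\<tau>\<leftarrow>is. E \<tau>)"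
    proof (induction "is")
      case (Cons \<tau> "is")
      then have "norm (elem_diff F \<tau> y) * (\<Prod>v\<leftarrow>map (\<lambda>\<tau>. elem_diff F \<tau> y) is. norm v) \<le> E \<tau> * (\<Prod>\<tau>\<leftarrow>is. E \<tau>)"
        using E[of \<tau> y] by (intro mult_mono) (auto intro!: prod_list_nonneg intro: order.trans[OF norm_ge_zero])
      then show ?case by simp
    qed simp
    have "elem_diff F (Node a M) y = nderiv (F a) ?vs y"
      unfolding elem_diff_Node M mset_map[symmetric] using len by (intro mderiv_mset[OF F]) simp
    then have "norm (elem_diff F (Node a M) y) \<le> b * (\<Prod>v\<leftarrow>?vs. norm v)"
      using b[of ?vs y] by simp
    also have "\<dots> \<le> \<bar>b\<bar> * (\<Prod>\<tau>\<leftarrow>is. E \<tau>)"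
      using nn le by (intro mult_mono) auto
    finally show ?thesis .
  qed
  then show ?case
    by blast
qed

lemma elem_diff_uniformly_bounded:
  fixes F :: "'a::finite \<Rightarrow> 'b::euclidean_space \<Rightarrow> 'b"
  assumes "\<And>a. Cb k (F a)"
  shows "\<exists>E\<ge>0. \<forall>\<tau>\<in>trees_upto (Suc k). \<forall>y. norm (elem_diff F \<tau> y) \<le> E"
proof -
  have "\<forall>\<tau>\<in>trees_upto (Suc k). \<exists>E. \<forall>y. norm (elem_diff F \<tau> y) \<le> E"
    using elem_diff_bounded[of k F] assms by (auto simp: trees_upto_def)
  then obtain E where E: "\<And>\<tau> y. \<tau> \<in> trees_upto (Suc k) \<Longrightarrow> norm (elem_diff F \<tau> y) \<le> E \<tau>"
    by metis
  have "norm (elem_diff F \<tau> y) \<le> (\<Sum>\<tau>\<in>trees_upto (Suc k). \<bar>E \<tau>\<bar>)" if "\<tau> \<in> trees_upto (Suc k)" for \<tau> y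
  proof -
    have "norm (elem_diff F \<tau> y) \<le> \<bar>E \<tau>\<bar>"
      using E[OF that, of y] by simp
    also have "\<dots> \<le> (\<Sum>\<tau>\<in>trees_upto (Suc k). \<bar>E \<tau>\<bar>)"
      using that by (intro member_le_sum finite_trees_upto) auto
    finally show ?thesis .
  qed
  then show ?thesis
    by (intro exI[of _ "\<Sum>\<tau>\<in>trees_upto (Suc k). \<bar>E \<tau>\<bar>"]) (auto intro: sum_nonneg)
qed

section \<open>Expansion of the stages and of the step\<close>

text \<open>
  The truncated B-series of \<open>F\<close> with coefficients \<open>c\<close>, without the term of the empty tree.
\<close>

definition B_series_upto :: "('a::finite \<Rightarrow> 'b \<Rightarrow> 'b::euclidean_space) \<Rightarrow> nat \<Rightarrow> ('a tree \<Rightarrow> real) \<Rightarrow> 'b \<Rightarrow> 'b"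
  where "B_series_upto F k c y = (\<Sum>\<tau>\<in>trees_upto k. (c \<tau> / real (symmetry \<tau>)) *\<^sub>R elem_diff F \<tau> y)"

text \<open>
  The vector field at a point that agrees with the tree expansion of a stage up to order \<open>k\<close>. By the
  Lipschitz bound on \<open>F a\<close> the point may be replaced by the expansion itself, and
  \<open>Taylor_multi_index\<close>, with trees as indices weighted by their number of vertices, then yields a sum
  over forests. The scale there is \<open>h = q c\<close>, for
  which the coefficient bound reads \<open>h ^ vertices \<tau>\<close>.
\<close>

lemma field_at_stage_expansion:
  fixes F :: "'a::finite \<Rightarrow> 'b::euclidean_space \<Rightarrow> 'b" and H L :: real
  assumes F: "\<And>a. Cb (Suc k) (F a)" and "H \<ge> 0" and "L \<ge> 0"
  shows "\<exists>K\<ge>0. \<forall>c (Z :: 'a \<Rightarrow> real ^ 'q ^ 'q) y x j. c \<le> H \<and> (\<forall>a i j. \<bar>Z a $ i $ j\<bar> \<le> c) \<and>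
    norm (x - (y + B_series_upto F k (\<lambda>\<tau>. stage_coeff Z \<tau> $ j) y)) \<le> L * c ^ Suc k \<longrightarrow>
    norm (F a x - (\<Sum>M\<in>forests_upto k. ((\<Prod>\<tau>\<in>#M. stage_coeff Z \<tau> $ j) / real (symmetry (Node a M)))
        *\<^sub>R elem_diff F (Node a M) y)) \<le> K * c ^ Suc k"
proof -
  obtain E where "E \<ge> 0" and E: "\<And>\<tau> y. \<tau> \<in> trees_upto (Suc k) \<Longrightarrow> norm (elem_diff F \<tau> y) \<le> E"
    using elem_diff_uniformly_bounded[of k F] Cb_mono[OF F] by (metis le_SucI order_refl)
  have "Cb (Suc 0) (F a)"
    by (rule Cb_mono[OF F]) simp
  from Cb_Taylor_bound[OF this] obtain B where "B \<ge> 0"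
    and "\<forall>x d. norm (F a (x + d) - (\<Sum>n\<le>0. (1 / fact n) *\<^sub>R nderiv (F a) (replicate n d) x)) \<le> B * norm d ^ Suc 0"
    by (elim exE conjE) (rule that)
  then have B: "norm (F a (x + d) - F a x) \<le> B * norm d" for x d
    by simp
  let ?q = "real CARD('q)"
  let ?G = "\<lambda>Z j y \<tau>. (stage_coeff Z \<tau> $ j / real (symmetry \<tau>)) *\<^sub>R elem_diff F \<tau> y"
  have "?q * H \<ge> 0"
    using \<open>H \<ge> 0\<close> by simp
  from Taylor_multi_index[where f = "F a" and w = vertices, OF F finite_trees_upto vertices_pos \<open>E \<ge> 0\<close> this, of k]
  obtain K where "K \<ge> 0" and K: "\<forall>h (g :: 'a tree \<Rightarrow> 'b) y. 0 \<le> h \<and> h \<le> ?q * H \<and>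
      (\<forall>\<tau>\<in>trees_upto k. norm (g \<tau>) \<le> E * h ^ vertices \<tau>) \<longrightarrow>
      norm (F a (y + (\<Sum>\<tau>\<in>trees_upto k. g \<tau>)) - (\<Sum>M\<in>forests_upto k.
        (1 / (\<Prod>\<tau>\<in>set_mset M. fact (count M \<tau>))) *\<^sub>R mderiv (F a) (image_mset g M) y)) \<le> K * h ^ Suc k"
    by (elim exE conjE) (rule that)
  have "norm (F a x - (\<Sum>M\<in>forests_upto k. ((\<Prod>\<tau>\<in>#M. stage_coeff Z \<tau> $ j) / real (symmetry (Node a M)))
        *\<^sub>R elem_diff F (Node a M) y)) \<le> (B * L + K * ?q ^ Suc k) * c ^ Suc k"
    if "c \<le> H" and Z: "\<forall>a i j. \<bar>Z a $ i $ j\<bar> \<le> c"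
      and x: "norm (x - (y + B_series_upto F k (\<lambda>\<tau>. stage_coeff Z \<tau> $ j) y)) \<le> L * c ^ Suc k"
    for c and Z :: "'a \<Rightarrow> real ^ 'q ^ 'q" and y x j
  proof -
    have c: "0 \<le> c"
      using Z order.trans abs_ge_zero by blast
    let ?x = "y + (\<Sum>\<tau>\<in>trees_upto k. ?G Z j y \<tau>)"
    let ?P = "\<Sum>M\<in>forests_upto k. (1 / (\<Prod>\<tau>\<in>set_mset M. fact (count M \<tau>))) *\<^sub>R
        mderiv (F a) (image_mset (?G Z j y) M) y"
    have P: "?P = (\<Sum>M\<in>forests_upto k. ((\<Prod>\<tau>\<in>#M. stage_coeff Z \<tau> $ j) / real (symmetry (Node a M)))
        *\<^sub>R elem_diff F (Node a M) y)"
    proof (intro sum.cong refl)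
      fix M :: "'a tree multiset" assume "M \<in> forests_upto k"
      then have "size M \<le> Suc k"
        using size_le_total_weight[of M vertices] vertices_pos
        by (fastforce simp: multi_indices_def intro: order.trans)
      from mderiv_scaleR[OF F this, of a "\<lambda>\<tau>. stage_coeff Z \<tau> $ j / real (symmetry \<tau>)" "\<lambda>\<tau>. elem_diff F \<tau> y" y]
      show "(1 / (\<Prod>\<tau>\<in>set_mset M. fact (count M \<tau>))) *\<^sub>R mderiv (F a) (image_mset (?G Z j y) M) y
          = ((\<Prod>\<tau>\<in>#M. stage_coeff Z \<tau> $ j) / real (symmetry (Node a M))) *\<^sub>R elem_diff F (Node a M) y"
        by (simp add: elem_diff_Node flip: inverse_symmetry_Node[where a = a] del: elem_diff.simps symmetry.simps)
    qed
    have small: "\<forall>\<tau>\<in>trees_upto k. norm (?G Z j y \<tau>) \<le> E * (?q * c) ^ vertices \<tau>"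
    proof
      fix \<tau> :: "'a tree" assume "\<tau> \<in> trees_upto k"
      then have e: "norm (elem_diff F \<tau> y) \<le> E"
        by (intro E) (simp add: trees_upto_def)
      have "\<bar>stage_coeff Z \<tau> $ j / real (symmetry \<tau>)\<bar> \<le> \<bar>stage_coeff Z \<tau> $ j\<bar>"
        by (cases "symmetry \<tau> = 0") (auto simp: divide_le_eq mult_le_cancel_left1)
      also have "\<dots> \<le> (?q * c) ^ vertices \<tau>"
        using Z by (intro abs_stage_coeff_le) blast
      finally show "norm (?G Z j y \<tau>) \<le> E * (?q * c) ^ vertices \<tau>"
        unfolding norm_scaleR mult.commute[of E] using e c by (intro mult_mono) auto
    qed
    have "norm (F a x - ?P) \<le> norm (F a x - F a ?x) + norm (F a ?x - ?P)"
      using norm_triangle_ineq[of "F a x - F a ?x" "F a ?x - ?P"] by simp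
    also have "norm (F a x - F a ?x) \<le> B * norm (x - ?x)"
      using B[of ?x "x - ?x"] by simp
    also have "B * norm (x - ?x) \<le> B * (L * c ^ Suc k)"
      using x \<open>B \<ge> 0\<close> unfolding B_series_upto_def by (rule mult_left_mono)
    also have "norm (F a ?x - ?P) \<le> K * (?q * c) ^ Suc k"
      using \<open>c \<le> H\<close> c small by (intro K[rule_format] conjI) (auto intro: mult_left_mono)
    finally show ?thesis
      unfolding P by (simp only: power_mult_distrib distrib_right mult.assoc)
  qed
  moreover have "B * L + K * ?q ^ Suc k \<ge> 0"
    using \<open>B \<ge> 0\<close> \<open>L \<ge> 0\<close> \<open>K \<ge> 0\<close> by simp
  ultimately show ?thesis
    by blast
qed

text \<open>
  One more order is gained because the weights \<open>z\<close> are \<open>O(c)\<close>: multiplying the forest expansion of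
  order \<open>k\<close> of the field by the weights adds the root, and the result is the tree expansion of order
  \<open>k + 1\<close>.
\<close>

lemma crk_map_expansion:
  fixes F :: "'a::finite \<Rightarrow> 'b::euclidean_space \<Rightarrow> 'b" and H L :: real
  assumes F: "\<And>a. Cb (Suc k) (F a)" and "H \<ge> 0" and "L \<ge> 0"
  shows "\<exists>K\<ge>0. \<forall>c (Z :: 'a \<Rightarrow> real ^ 'q ^ 'q) z y Y. c \<le> H \<and> (\<forall>a i j. \<bar>Z a $ i $ j\<bar> \<le> c) \<and>
    (\<forall>a j. \<bar>z a $ j\<bar> \<le> c) \<and>
    (\<forall>j. norm (Y j - (y + B_series_upto F k (\<lambda>\<tau>. stage_coeff Z \<tau> $ j) y)) \<le> L * c ^ Suc k) \<longrightarrow>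
    norm (crk_map F z Y y - (y + B_series_upto F (Suc k) (step_coeff Z z) y)) \<le> K * c ^ Suc (Suc k)"
proof -
  let ?T = "\<lambda>(Z :: 'a \<Rightarrow> real ^ 'q ^ 'q) y a j M.
    ((\<Prod>\<tau>\<in>#M. stage_coeff Z \<tau> $ j) / real (symmetry (Node a M))) *\<^sub>R elem_diff F (Node a M) y"
  have "\<forall>a. \<exists>K. K \<ge> 0 \<and> (\<forall>c (Z :: 'a \<Rightarrow> real ^ 'q ^ 'q) y x j. c \<le> H \<and> (\<forall>a i j. \<bar>Z a $ i $ j\<bar> \<le> c) \<and>
    norm (x - (y + B_series_upto F k (\<lambda>\<tau>. stage_coeff Z \<tau> $ j) y)) \<le> L * c ^ Suc k \<longrightarrow>
    norm (F a x - (\<Sum>M\<in>forests_upto k. ?T Z y a j M)) \<le> K * c ^ Suc k)"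
    using field_at_stage_expansion[OF F \<open>H \<ge> 0\<close> \<open>L \<ge> 0\<close>, where 'q = 'q] by (rule allI)
  then obtain K where K0: "\<And>a. K a \<ge> 0"
    and K: "\<And>a c (Z :: 'a \<Rightarrow> real ^ 'q ^ 'q) y x j. c \<le> H \<Longrightarrow> (\<forall>a i j. \<bar>Z a $ i $ j\<bar> \<le> c) \<Longrightarrow>
      norm (x - (y + B_series_upto F k (\<lambda>\<tau>. stage_coeff Z \<tau> $ j) y)) \<le> L * c ^ Suc k \<Longrightarrow>
      norm (F a x - (\<Sum>M\<in>forests_upto k. ?T Z y a j M)) \<le> K a * c ^ Suc k"
    by (elim exE[OF choice]) blast
  have "norm (crk_map F z Y y - (y + B_series_upto F (Suc k) (step_coeff Z z) y))
      \<le> (real CARD('q) * (\<Sum>a\<in>UNIV. K a)) * c ^ Suc (Suc k)"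
    if cH: "c \<le> H" and Z: "\<forall>a i j. \<bar>Z a $ i $ j\<bar> \<le> c" and z: "\<forall>a j. \<bar>z a $ j\<bar> \<le> c"
      and Y: "\<forall>j. norm (Y j - (y + B_series_upto F k (\<lambda>\<tau>. stage_coeff Z \<tau> $ j) y)) \<le> L * c ^ Suc k"
    for c and Z :: "'a \<Rightarrow> real ^ 'q ^ 'q" and z y Y
  proof -
    have c: "0 \<le> c"
      using Z order.trans abs_ge_zero by blast
    have node: "(step_coeff Z z (Node a M) / real (symmetry (Node a M))) *\<^sub>R elem_diff F (Node a M) y
        = (\<Sum>j\<in>UNIV. z a $ j *\<^sub>R ?T Z y a j M)" for a M
      unfolding step_coeff_Node sum_divide_distrib scaleR_sum_left
      by (simp only: scaleR_scaleR times_divide_eq_right)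
    have "B_series_upto F (Suc k) (step_coeff Z z) y
        = (\<Sum>a\<in>UNIV. \<Sum>M\<in>forests_upto k. \<Sum>j\<in>UNIV. z a $ j *\<^sub>R ?T Z y a j M)"
      unfolding B_series_upto_def sum_trees_upto_Suc node ..
    also have "\<dots> = (\<Sum>a\<in>UNIV. \<Sum>j\<in>UNIV. z a $ j *\<^sub>R (\<Sum>M\<in>forests_upto k. ?T Z y a j M))"
      unfolding scaleR_sum_right by (intro sum.cong refl sum.swap)
    finally have "crk_map F z Y y - (y + B_series_upto F (Suc k) (step_coeff Z z) y)
        = (\<Sum>a\<in>UNIV. \<Sum>j\<in>UNIV. z a $ j *\<^sub>R (F a (Y j) - (\<Sum>M\<in>forests_upto k. ?T Z y a j M)))"
      unfolding crk_map_def scaleR_diff_right sum_subtractf by simp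
    also have "norm \<dots> \<le> (\<Sum>a\<in>UNIV. \<Sum>j\<in>(UNIV :: 'q set). c * (K a * c ^ Suc k))"
    proof (intro sum_norm_le)
      fix a j
      show "norm (z a $ j *\<^sub>R (F a (Y j) - (\<Sum>M\<in>forests_upto k. ?T Z y a j M))) \<le> c * (K a * c ^ Suc k)"
        unfolding norm_scaleR using z c by (intro mult_mono K[OF cH Z] Y[rule_format]) auto
    qed
    also have "\<dots> = (real CARD('q) * (\<Sum>a\<in>UNIV. K a)) * c ^ Suc (Suc k)"
      by (simp add: sum_distrib_left sum_distrib_right mult_ac)
    finally show ?thesis .
  qed
  moreover have "real CARD('q) * (\<Sum>a\<in>UNIV. K a) \<ge> 0"
    using K0 by (intro mult_nonneg_nonneg sum_nonneg) auto
  ultimately show ?thesis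
    by blast
qed

lemma stage_solution_iff_crk_map:
  "stage_solution F Z y Y \<longleftrightarrow> (\<forall>i. Y i = crk_map F (\<lambda>a. Z a $ i) Y y)"
  by (simp add: stage_solution_def crk_map_def)

text \<open>
  Bootstrapping: the boundedness of the fields gives order \<open>0\<close>, and inserting the expansion of order
  \<open>k\<close> into the right-hand side of the stage system raises the order by one.
\<close>

lemma stage_expansion:
  fixes F :: "'a::finite \<Rightarrow> 'b::euclidean_space \<Rightarrow> 'b" and H :: real
  assumes "\<And>a. Cb k (F a)" and "H \<ge> 0"
  shows "\<exists>K\<ge>0. \<forall>c (Z :: 'a \<Rightarrow> real ^ 'q ^ 'q) y Y i. c \<le> H \<and> (\<forall>a i j. \<bar>Z a $ i $ j\<bar> \<le> c) \<and>
    stage_solution F Z y Y \<longrightarrow>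
    norm (Y i - (y + B_series_upto F k (\<lambda>\<tau>. stage_coeff Z \<tau> $ i) y)) \<le> K * c ^ Suc k"
  using assms(1)
proof (induction k)
  case 0
  have "\<exists>b. \<forall>y. norm (F a y) \<le> b" for a
    using Cb_bounded[OF 0, of 0 a] by auto
  then obtain b where b: "\<And>a y. norm (F a y) \<le> b a"
    by metis
  have b0: "b a \<ge> 0" for a
    using b norm_ge_zero order.trans by blast
  have empty: "trees_upto 0 = ({} :: 'a tree set)"
    using vertices_pos not_less_eq_eq by (fastforce simp: trees_upto_def)
  have "norm (Y i - (y + B_series_upto F 0 (\<lambda>\<tau>. stage_coeff Z \<tau> $ i) y))
      \<le> (real CARD('q) * (\<Sum>a\<in>UNIV. b a)) * c ^ Suc 0"
    if Z: "\<forall>a i j. \<bar>Z a $ i $ j\<bar> \<le> c" and Y: "stage_solution F Z y Y"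
    for c and Z :: "'a \<Rightarrow> real ^ 'q ^ 'q" and y Y i
  proof -
    have c: "0 \<le> c"
      using Z order.trans abs_ge_zero by blast
    have "Y i = y + (\<Sum>a\<in>UNIV. \<Sum>j\<in>UNIV. (Z a $ i $ j) *\<^sub>R F a (Y j))"
      using Y unfolding stage_solution_def by blast
    then have "Y i - (y + B_series_upto F 0 (\<lambda>\<tau>. stage_coeff Z \<tau> $ i) y)
        = (\<Sum>a\<in>UNIV. \<Sum>j\<in>UNIV. (Z a $ i $ j) *\<^sub>R F a (Y j))"
      by (simp add: B_series_upto_def empty)
    also have "norm \<dots> \<le> (\<Sum>a\<in>UNIV. \<Sum>j\<in>(UNIV :: 'q set). c * b a)"
      using Z c b b0 by (intro sum_norm_le) (auto simp: intro!: mult_mono)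
    also have "\<dots> = (real CARD('q) * (\<Sum>a\<in>UNIV. b a)) * c ^ Suc 0"
      by (simp add: sum_distrib_left sum_distrib_right mult_ac)
    finally show ?thesis .
  qed
  moreover have "real CARD('q) * (\<Sum>a\<in>UNIV. b a) \<ge> 0"
    using b0 by (intro mult_nonneg_nonneg sum_nonneg) auto
  ultimately show ?case
    by blast
next
  case (Suc k)
  have "Cb k (F a)" for a
    by (rule Cb_mono[OF Suc.prems]) simp
  from Suc.IH[OF this] obtain L where "L \<ge> 0"
    and L: "\<forall>c (Z :: 'a \<Rightarrow> real ^ 'q ^ 'q) y Y i. c \<le> H \<and> (\<forall>a i j. \<bar>Z a $ i $ j\<bar> \<le> c) \<and>
      stage_solution F Z y Y \<longrightarrow>
      norm (Y i - (y + B_series_upto F k (\<lambda>\<tau>. stage_coeff Z \<tau> $ i) y)) \<le> L * c ^ Suc k"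
    by (elim exE conjE) (rule that)
  from crk_map_expansion[where F = F, OF Suc.prems \<open>H \<ge> 0\<close> \<open>L \<ge> 0\<close>, where 'q = 'q] obtain K where "K \<ge> 0"
    and K: "\<forall>c (Z :: 'a \<Rightarrow> real ^ 'q ^ 'q) z y Y. c \<le> H \<and> (\<forall>a i j. \<bar>Z a $ i $ j\<bar> \<le> c) \<and>
      (\<forall>a j. \<bar>z a $ j\<bar> \<le> c) \<and>
      (\<forall>j. norm (Y j - (y + B_series_upto F k (\<lambda>\<tau>. stage_coeff Z \<tau> $ j) y)) \<le> L * c ^ Suc k) \<longrightarrow>
      norm (crk_map F z Y y - (y + B_series_upto F (Suc k) (step_coeff Z z) y)) \<le> K * c ^ Suc (Suc k)"
    by (elim exE conjE) (rule that)
  have "norm (Y i - (y + B_series_upto F (Suc k) (\<lambda>\<tau>. stage_coeff Z \<tau> $ i) y)) \<le> K * c ^ Suc (Suc k)"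
    if "c \<le> H" and "\<forall>a i j. \<bar>Z a $ i $ j\<bar> \<le> c" and Y: "stage_solution F Z y Y"
    for c and Z :: "'a \<Rightarrow> real ^ 'q ^ 'q" and y Y i
  proof -
    have "norm (crk_map F (\<lambda>a. Z a $ i) Y y - (y + B_series_upto F (Suc k) (step_coeff Z (\<lambda>a. Z a $ i)) y))
        \<le> K * c ^ Suc (Suc k)"
      using that L by (intro K[rule_format]) blast
    also have "crk_map F (\<lambda>a. Z a $ i) Y y = Y i"
      using Y by (metis stage_solution_iff_crk_map)
    finally show ?thesis
      by (simp only: stage_coeff_eq_step_coeff)
  qed
  with \<open>K \<ge> 0\<close> show ?case
    by blast
qed

lemma abs_entry_le_mat_infnorm:
  fixes A :: "real ^ 'q ^ 'q"
  shows "\<bar>A $ i $ j\<bar> \<le> mat_infnorm A"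
proof -
  have axis: "infnorm (axis j 1 :: real ^ 'q) = 1"
    using infnorm_le_norm[of "axis j 1 :: real ^ 'q"] component_le_infnorm_cart[of "axis j 1 :: real ^ 'q" j]
    by (simp add: norm_axis_1)
  have "\<bar>A $ i $ j\<bar> = \<bar>(A *v axis j 1) $ i\<bar>"
    by (simp add: matrix_vector_mult_basis column_def)
  also have "\<dots> \<le> infnorm (A *v axis j 1)"
    by (rule component_le_infnorm_cart)
  also have "\<dots> = infnorm (A *v axis j 1) / infnorm (axis j 1 :: real ^ 'q)"
    by (simp add: axis)
  also have "\<dots> \<le> mat_infnorm A"
    unfolding mat_infnorm_def by (intro cSUP_upper bdd_above_mat_infnorm UNIV_I)
  finally show ?thesis .
qed

theorem theorem4p6:
  fixes \<alpha> T C\<^sub>C\<^sub>R\<^sub>K :: real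
    and p :: nat
    and F :: "'m::finite \<Rightarrow> real ^ 'e \<Rightarrow> real ^ 'e"
    and Z :: "real \<Rightarrow> real \<Rightarrow> 'm \<Rightarrow> real ^ 'q ^ 'q"
    and \<zeta> :: "real \<Rightarrow> real \<Rightarrow> 'm \<Rightarrow> real ^ 'q"
    and Y :: "real \<Rightarrow> real \<Rightarrow> real ^ 'e \<Rightarrow> 'q \<Rightarrow> real ^ 'e"
  assumes "1 / 3 < \<alpha>" and "\<alpha> \<le> 1 / 2"
    and "T > 0"
    and "p \<ge> 1" and "(real p + 1) * \<alpha> > 1"
    and "\<And>a. Cb (p + 1) (F a)"
    and "C\<^sub>C\<^sub>R\<^sub>K > 0"
    and "\<And>u v a. 0 \<le> u \<Longrightarrow> u \<le> v \<Longrightarrow> v \<le> T \<Longrightarrow>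
           mat_infnorm (Z u v a) + infnorm (\<zeta> u v a) \<le> C\<^sub>C\<^sub>R\<^sub>K * \<bar>v - u\<bar> powr \<alpha>"
    and "\<And>u v y. 0 \<le> u \<Longrightarrow> u \<le> v \<Longrightarrow> v \<le> T \<Longrightarrow> stage_solution F (Z u v) y (Y u v y)"
  shows "\<forall>R>0. \<exists>C>0. \<forall>u v y. 0 \<le> u \<and> u \<le> v \<and> v \<le> T \<and> norm y \<le> R \<longrightarrow>
    (\<exists>(Rem\<^sub>Y :: 'q \<Rightarrow> real ^ 'e) (Rem\<^sub>\<Psi> :: real ^ 'e).
      (\<forall>i. Y u v y i = y
         + (\<Sum>\<tau>\<in>trees_upto p. (stage_coeff (Z u v) \<tau> $ i / real (symmetry \<tau>)) *\<^sub>R elem_diff F \<tau> y)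
         + Rem\<^sub>Y i) \<and>
      crk_map F (\<zeta> u v) (Y u v y) y = y
         + (\<Sum>\<tau>\<in>trees_upto p. (step_coeff (Z u v) (\<zeta> u v) \<tau> / real (symmetry \<tau>)) *\<^sub>R elem_diff F \<tau> y)
         + Rem\<^sub>\<Psi> \<and>
      (MAX i. norm (Rem\<^sub>Y i)) + norm Rem\<^sub>\<Psi> \<le> C * \<bar>v - u\<bar> powr ((real p + 1) * \<alpha>))"
proof -
  define H where "H = C\<^sub>C\<^sub>R\<^sub>K * T powr \<alpha>"
  have "H \<ge> 0"
    using \<open>C\<^sub>C\<^sub>R\<^sub>K > 0\<close> by (simp add: H_def)
  \<comment> \<open>Stages known up to order \<open>k = p - 1\<close> suffice: both claims are steps that raise this order to \<open>p\<close>.\<close>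
  obtain k where p: "p = Suc k"
    using \<open>p \<ge> 1\<close> by (cases p) auto
  have Cbk: "Cb k (F a)" and CbSk: "Cb (Suc k) (F a)" for a
    using Cb_mono[OF assms(6)] by (simp_all add: p)
  from stage_expansion[where F = F, OF Cbk \<open>H \<ge> 0\<close>, where 'q = 'q] obtain L where "L \<ge> 0"
    and L: "\<forall>c (Z :: 'm \<Rightarrow> real ^ 'q ^ 'q) y Y i. c \<le> H \<and> (\<forall>a i j. \<bar>Z a $ i $ j\<bar> \<le> c) \<and>
      stage_solution F Z y Y \<longrightarrow>
      norm (Y i - (y + B_series_upto F k (\<lambda>\<tau>. stage_coeff Z \<tau> $ i) y)) \<le> L * c ^ Suc k"
    by (elim exE conjE) (rule that)
  from crk_map_expansion[where F = F, OF CbSk \<open>H \<ge> 0\<close> \<open>L \<ge> 0\<close>, where 'q = 'q] obtain K where "K \<ge> 0"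
    and K: "\<forall>c (Z :: 'm \<Rightarrow> real ^ 'q ^ 'q) z y Y. c \<le> H \<and> (\<forall>a i j. \<bar>Z a $ i $ j\<bar> \<le> c) \<and>
      (\<forall>a j. \<bar>z a $ j\<bar> \<le> c) \<and>
      (\<forall>j. norm (Y j - (y + B_series_upto F k (\<lambda>\<tau>. stage_coeff Z \<tau> $ j) y)) \<le> L * c ^ Suc k) \<longrightarrow>
      norm (crk_map F z Y y - (y + B_series_upto F (Suc k) (step_coeff Z z) y)) \<le> K * c ^ Suc (Suc k)"
    by (elim exE conjE) (rule that)
  \<comment> \<open>One \<open>K\<close> each for the stages and the step; the \<open>1\<close> makes \<open>C\<close> positive when \<open>K = 0\<close>.\<close>
  define C where "C = 2 * K * C\<^sub>C\<^sub>R\<^sub>K ^ Suc p + 1"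
  have "C > 0"
    using \<open>K \<ge> 0\<close> \<open>C\<^sub>C\<^sub>R\<^sub>K > 0\<close> by (simp add: C_def add_nonneg_pos)
  have "\<exists>(Rem\<^sub>Y :: 'q \<Rightarrow> real ^ 'e) (Rem\<^sub>\<Psi> :: real ^ 'e).
      (\<forall>i. Y u v y i = y
         + (\<Sum>\<tau>\<in>trees_upto p. (stage_coeff (Z u v) \<tau> $ i / real (symmetry \<tau>)) *\<^sub>R elem_diff F \<tau> y)
         + Rem\<^sub>Y i) \<and>
      crk_map F (\<zeta> u v) (Y u v y) y = y
         + (\<Sum>\<tau>\<in>trees_upto p. (step_coeff (Z u v) (\<zeta> u v) \<tau> / real (symmetry \<tau>)) *\<^sub>R elem_diff F \<tau> y)
         + Rem\<^sub>\<Psi> \<and>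
      (MAX i. norm (Rem\<^sub>Y i)) + norm Rem\<^sub>\<Psi> \<le> C * \<bar>v - u\<bar> powr ((real p + 1) * \<alpha>)"
    if uv: "0 \<le> u" "u \<le> v" "v \<le> T" for u v y
  proof -
    define c where "c = C\<^sub>C\<^sub>R\<^sub>K * \<bar>v - u\<bar> powr \<alpha>"
    have cH: "c \<le> H"
      unfolding c_def H_def using uv \<open>C\<^sub>C\<^sub>R\<^sub>K > 0\<close> \<open>1 / 3 < \<alpha>\<close>
      by (intro mult_left_mono powr_mono2) auto
    have Zc: "\<bar>Z u v a $ i $ j\<bar> \<le> c" for a i j
      using abs_entry_le_mat_infnorm[of "Z u v a" i j] assms(8)[OF uv, of a] infnorm_pos_le[of "\<zeta> u v a"]
      by (simp add: c_def)
    have \<zeta>c: "\<bar>\<zeta> u v a $ j\<bar> \<le> c" for a j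
      using component_le_infnorm_cart[of "\<zeta> u v a" j] abs_entry_le_mat_infnorm[of "Z u v a" j j]
        assms(8)[OF uv, of a] by (simp add: c_def)
    have sol: "stage_solution F (Z u v) y (Y u v y)"
      using uv by (rule assms(9))
    have low: "\<forall>j. norm (Y u v y j - (y + B_series_upto F k (\<lambda>\<tau>. stage_coeff (Z u v) \<tau> $ j) y)) \<le> L * c ^ Suc k"
      using L cH Zc sol by blast
    \<comment> \<open>The remainder as a function of the weights: rows of \<open>Z u v\<close> give the stages, \<open>\<zeta> u v\<close> the step.\<close>
    define r where "r z = crk_map F z (Y u v y) y - (y + B_series_upto F p (step_coeff (Z u v) z) y)" for z
    have r: "norm (r z) \<le> K * c ^ Suc p" if "\<forall>a j. \<bar>z a $ j\<bar> \<le> c" for z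
      unfolding r_def p using K cH Zc that low by blast
    have "Y u v y i = y + B_series_upto F p (\<lambda>\<tau>. stage_coeff (Z u v) \<tau> $ i) y + r (\<lambda>a. Z u v a $ i)" for i
      using sol unfolding r_def stage_solution_iff_crk_map stage_coeff_eq_step_coeff by auto
    moreover have "crk_map F (\<zeta> u v) (Y u v y) y
        = y + B_series_upto F p (step_coeff (Z u v) (\<zeta> u v)) y + r (\<zeta> u v)"
      by (simp add: r_def)
    moreover have "(MAX i. norm (r (\<lambda>a. Z u v a $ i))) + norm (r (\<zeta> u v))
        \<le> C * \<bar>v - u\<bar> powr ((real p + 1) * \<alpha>)"
    proof -
      have "norm (r (\<lambda>a. Z u v a $ i)) \<le> K * c ^ Suc p" for i
        by (rule r) (simp add: Zc)
      then have "(MAX i. norm (r (\<lambda>a. Z u v a $ i))) \<le> K * c ^ Suc p"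
        by (intro Max.boundedI) (auto simp del: power_Suc)
      moreover have "norm (r (\<zeta> u v)) \<le> K * c ^ Suc p"
        by (rule r) (simp add: \<zeta>c)
      moreover have c_power: "c ^ Suc p = C\<^sub>C\<^sub>R\<^sub>K ^ Suc p * \<bar>v - u\<bar> powr ((real p + 1) * \<alpha>)"
      proof (cases "v = u")
        case False
        then show ?thesis
          unfolding c_def power_mult_distrib by (subst powr_power) (simp_all add: add.commute)
      qed (simp add: c_def)
      moreover have "2 * (K * c ^ Suc p) \<le> C * \<bar>v - u\<bar> powr ((real p + 1) * \<alpha>)"
        unfolding C_def c_power distrib_right by (simp add: mult.assoc)
      ultimately show ?thesis
        by linarith
    qed
    ultimately show ?thesis
      unfolding B_series_upto_def
      by (intro exI[of _ "\<lambda>i. r (\<lambda>a. Z u v a $ i)"] exI[of _ "r (\<zeta> u v)"] conjI allI)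
  qed
  then show ?thesis
    using \<open>C > 0\<close> by blast
qed

end
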